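(* For any matrix $M$ over a field $\mathbb{F}$, $$\sigma(M)=\sup_{\alpha\in[0,1]}\sigma_\alpha(M).$$ Moreover, for any binary matrix $M$, $\sigma_{\mathsf{OR}}(M)=\sup_{\alpha\in[0,1]}\sigma_{\mathsf{OR},\alpha}(M)$ and $\sigma_{\mathsf{PAR}}(M)=\sup_{\alpha\in[0,1]}\sigma_{\mathsf{PAR},\alpha}(M)$.
   Context: $\operatorname{nnz}$ counts nonzero entries; $M^{\otimes n}$ is the Kronecker power. A decomposition of a matrix $M\in\mathbb{F}^{p\times q}$ is a finite indexed family of nonzero vectors $U_i\in\mathbb{F}^p$, $V_i\in\mathbb{F}^q$ ($i\in I$) with $M=\sum_{i\in I}U_iV_i^{\mathsf T}$. Its size is $\sum_{i\in I}(\operatorname{nnz}(U_i)+\operatorname{nnz}(V_i))$, and for $\alpha\in[0,1]$ its $\alpha$-volume is $\rho_I(\alpha)=\sum_{i\in I}\operatorname{nnz}(U_i)^\alpha\operatorname{nnz}(V_i)^{1-\alpha}$. Let $\operatorname{S}(M)$ be the minimum size, and $\operatorname{S}_\alpha(M)$ the infimum of the $\alpha$-volume, over all decompositions of $M$. Define $\sigma(M)=\lim_{n\to\infty}\operatorname{S}(M^{\otimes n})^{1/n}$ and $\sigma_\alpha(M)=\lim_{n\to\infty}\operatorname{S}_\alpha(M^{\otimes n})^{1/n}$ (the limits exist by submultiplicativity). For binary $M\in\{0,1\}^{I_0\times J_0}$, a covering of $M$ is a finite family of rectangles $A_i\times B_i$ ($\emptyset\ne A_i\subseteq I_0$, $\emptyset\neq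 B_i\subseteq J_0$) whose union is $\operatorname{supp}(M)$; a partitioning is such a family whose disjoint union is $\operatorname{supp}(M)$. The size of such a family is $\sum_i(|A_i|+|B_i|)$ and its $\alpha$-volume is $\sum_i|A_i|^\alpha|B_i|^{1-\alpha}$. The quantities $\sigma_{\mathsf{OR}},\sigma_{\mathsf{OR},\alpha}$ (resp. $\sigma_{\mathsf{PAR}},\sigma_{\mathsf{PAR},\alpha}$) are defined exactly as $\sigma,\sigma_\alpha$, with decompositions replaced by coverings (resp. partitionings) of $M^{\otimes n}$. *)

theory Defs
  imports
    Complex_Main
    "HOL-Library.Disjoint_Sets"
    "Jordan_Normal_Form.Matrix"
begin

definition kronecker :: "'a::semiring_1 mat \<Rightarrow> 'a mat \<Rightarrow> 'a mat" where
  "kronecker A B =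
     mat (dim_row A * dim_row B) (dim_col A * dim_col B)
       (\<lambda>(i, j). A $$ (i div dim_row B, j div dim_col B) * B $$ (i mod dim_row B, j mod dim_col B))"

primrec kronecker_power :: "'a::semiring_1 mat \<Rightarrow> nat \<Rightarrow> 'a mat" where
  "kronecker_power M 0 = 1\<^sub>m 1"
| "kronecker_power M (Suc n) = kronecker M (kronecker_power M n)"

definition nnz :: "'a::zero vec \<Rightarrow> nat" where
  "nnz v = card {i. i < dim_vec v \<and> v $ i \<noteq> 0}"

(* Index sets of all finite families are finite sets of naturals; neither the size nor the
   alpha-volume changes under reindexing, so this is no restriction. An empty index set is allowed
   (the zero matrix is the empty sum). *)

definition is_decomposition ::
  "'a::semiring_1 mat \<Rightarrow> nat set \<Rightarrow> (nat \<Rightarrow> 'a vec) \<Rightarrow> (nat \<Rightarrow> 'a vec) \<Rightarrow> bool" where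
  "is_decomposition M I U V \<longleftrightarrow>
     finite I \<and>
     (\<forall>k\<in>I. U k \<in> carrier_vec (dim_row M) \<and> U k \<noteq> 0\<^sub>v (dim_row M)) \<and>
     (\<forall>k\<in>I. V k \<in> carrier_vec (dim_col M) \<and> V k \<noteq> 0\<^sub>v (dim_col M)) \<and>
     M = mat (dim_row M) (dim_col M) (\<lambda>(i, j). \<Sum>k\<in>I. U k $ i * V k $ j)"

definition decomp_size :: "nat set \<Rightarrow> (nat \<Rightarrow> 'a::zero vec) \<Rightarrow> (nat \<Rightarrow> 'a vec) \<Rightarrow> nat" where
  "decomp_size I U V = (\<Sum>k\<in>I. nnz (U k) + nnz (V k))"

definition decomp_volume ::
  "real \<Rightarrow> nat set \<Rightarrow> (nat \<Rightarrow> 'a::zero vec) \<Rightarrow> (nat \<Rightarrow> 'a vec) \<Rightarrow> real" where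
  "decomp_volume \<alpha> I U V = (\<Sum>k\<in>I. real (nnz (U k)) powr \<alpha> * real (nnz (V k)) powr (1 - \<alpha>))"

definition min_size :: "'a::semiring_1 mat \<Rightarrow> nat" where
  "min_size M = (LEAST s. \<exists>I U V. is_decomposition M I U V \<and> s = decomp_size I U V)"

definition inf_volume :: "real \<Rightarrow> 'a::semiring_1 mat \<Rightarrow> real" where
  "inf_volume \<alpha> M = Inf {decomp_volume \<alpha> I U V | I U V. is_decomposition M I U V}"

definition sigma :: "'a::semiring_1 mat \<Rightarrow> real" where
  "sigma M = lim (\<lambda>n. root n (real (min_size (kronecker_power M n))))"

definition sigma_alpha :: "real \<Rightarrow> 'a::semiring_1 mat \<Rightarrow> real" where
  "sigma_alpha \<alpha> M = lim (\<lambda>n. root n (inf_volume \<alpha> (kronecker_power M n)))"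

definition binary_mat :: "'a::zero_neq_one mat \<Rightarrow> bool" where
  "binary_mat M \<longleftrightarrow> elements_mat M \<subseteq> {0, 1}"

definition supp_mat :: "'a::zero mat \<Rightarrow> (nat \<times> nat) set" where
  "supp_mat M = {(i, j). i < dim_row M \<and> j < dim_col M \<and> M $$ (i, j) \<noteq> 0}"

definition is_covering ::
  "'a::zero mat \<Rightarrow> nat set \<Rightarrow> (nat \<Rightarrow> nat set) \<Rightarrow> (nat \<Rightarrow> nat set) \<Rightarrow> bool" where
  "is_covering M I A B \<longleftrightarrow>
     finite I \<and>
     (\<forall>k\<in>I. A k \<noteq> {} \<and> A k \<subseteq> {..<dim_row M}) \<and>
     (\<forall>k\<in>I. B k \<noteq> {} \<and> B k \<subseteq> {..<dim_col M}) \<and>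
     (\<Union>k\<in>I. A k \<times> B k) = supp_mat M"

definition is_partitioning ::
  "'a::zero mat \<Rightarrow> nat set \<Rightarrow> (nat \<Rightarrow> nat set) \<Rightarrow> (nat \<Rightarrow> nat set) \<Rightarrow> bool" where
  "is_partitioning M I A B \<longleftrightarrow>
     is_covering M I A B \<and> disjoint_family_on (\<lambda>k. A k \<times> B k) I"

definition rect_size :: "nat set \<Rightarrow> (nat \<Rightarrow> nat set) \<Rightarrow> (nat \<Rightarrow> nat set) \<Rightarrow> nat" where
  "rect_size I A B = (\<Sum>k\<in>I. card (A k) + card (B k))"

definition rect_volume ::
  "real \<Rightarrow> nat set \<Rightarrow> (nat \<Rightarrow> nat set) \<Rightarrow> (nat \<Rightarrow> nat set) \<Rightarrow> real" where
  "rect_volume \<alpha> I A B = (\<Sum>k\<in>I. real (card (A k)) powr \<alpha> * real (card (B k)) powr (1 - \<alpha>))"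

definition min_size_OR :: "'a::zero mat \<Rightarrow> nat" where
  "min_size_OR M = (LEAST s. \<exists>I A B. is_covering M I A B \<and> s = rect_size I A B)"

definition inf_volume_OR :: "real \<Rightarrow> 'a::zero mat \<Rightarrow> real" where
  "inf_volume_OR \<alpha> M = Inf {rect_volume \<alpha> I A B | I A B. is_covering M I A B}"

definition sigma_OR :: "'a::semiring_1 mat \<Rightarrow> real" where
  "sigma_OR M = lim (\<lambda>n. root n (real (min_size_OR (kronecker_power M n))))"

definition sigma_OR_alpha :: "real \<Rightarrow> 'a::semiring_1 mat \<Rightarrow> real" where
  "sigma_OR_alpha \<alpha> M = lim (\<lambda>n. root n (inf_volume_OR \<alpha> (kronecker_power M n)))"

definition min_size_PAR :: "'a::zero mat \<Rightarrow> nat" where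
  "min_size_PAR M = (LEAST s. \<exists>I A B. is_partitioning M I A B \<and> s = rect_size I A B)"

definition inf_volume_PAR :: "real \<Rightarrow> 'a::zero mat \<Rightarrow> real" where
  "inf_volume_PAR \<alpha> M = Inf {rect_volume \<alpha> I A B | I A B. is_partitioning M I A B}"

definition sigma_PAR :: "'a::semiring_1 mat \<Rightarrow> real" where
  "sigma_PAR M = lim (\<lambda>n. root n (real (min_size_PAR (kronecker_power M n))))"

definition sigma_PAR_alpha :: "real \<Rightarrow> 'a::semiring_1 mat \<Rightarrow> real" where
  "sigma_PAR_alpha \<alpha> M = lim (\<lambda>n. root n (inf_volume_PAR \<alpha> (kronecker_power M n)))"

end

theory Submission
  imports Defs "HOL-Library.Nat_Bijection"
begin

text \<open>The inequality \<open>\<ge>\<close> holds because \<open>u\<^sup>\<alpha> v\<^sup>1\<^sup>-\<^sup>\<alpha> \<le> u + v\<close>.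
  For \<open>\<le>\<close>, let \<open>t\<close> exceed the supremum. Side lengths at level \<open>n\<close> are at most \<open>D\<^sup>n\<close>, so
  the \<open>n\<close>-th root of the \<open>\<alpha>\<close>-volume is Lipschitz in \<open>\<alpha>\<close> on a logarithmic scale, uniformly in
  \<open>n\<close>; a finite grid of exponents then gives one \<open>n\<close> at which every \<open>\<alpha>\<close> has a family of
  \<open>\<alpha>\<close>-volume at most \<open>T = t\<^sup>n\<close>. Tensor these families together adaptively: a term with side
  lengths \<open>(a, b)\<close> is multiplied by the family that is good for
  \<open>w = a\<^sup>\<epsilon> / (a\<^sup>\<epsilon> + b\<^sup>\<epsilon>)\<close>. The potential \<open>(a\<^sup>\<epsilon> + b\<^sup>\<epsilon>)\<^sup>1\<^sup>/\<^sup>\<epsilon>\<close> dominates \<open>a\<close> and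
  \<open>b\<close>, and its total grows per step by at most \<open>T\<close> times a factor tending to \<open>1\<close> as
  \<open>\<epsilon> \<rightarrow> 0\<close>, since the power mean with weights \<open>w, 1 - w\<close> tends to the geometric mean.\<close>

section \<open>Submultiplicative sequences\<close>

text \<open>Fekete's lemma with \<open>L\<close> the infimum of the roots over
  \<open>n \<ge> 1\<close>. For \<open>t > L\<close> some block length \<open>m\<close> has
  \<open>a m \<le> t ^ m\<close>; dividing \<open>n\<close> by \<open>m\<close> with remainder then
  gives \<open>a n \<le> C * t ^ n\<close> with \<open>C\<close> independent of \<open>n\<close>.
  Avoiding logarithms admits sequences with zero values.\<close>

lemma fekete_root:
  fixes a :: "nat \<Rightarrow> real"
  assumes nonneg: "\<And>n. 0 \<le> a n" and submult: "\<And>m n. a (m + n) \<le> a m * a n"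
  obtains L where "(\<lambda>n. root n (a n)) \<longlonglongrightarrow> L" "0 \<le> L" "\<And>n. 1 \<le> n \<Longrightarrow> L ^ n \<le> a n"
proof -
  define L where "L = (INF n\<in>{1..}. root n (a n))"
  have bdd: "bdd_below ((\<lambda>n. root n (a n)) ` {1..})"
    by (rule bdd_belowI[of _ 0]) (auto simp: nonneg)
  have low: "L \<le> root n (a n)" if "1 \<le> n" for n
    unfolding L_def using that by (intro cINF_lower bdd) auto
  have L0: "0 \<le> L"
    unfolding L_def by (rule cINF_greatest) (auto simp: nonneg)
  have pow: "L ^ n \<le> a n" if "1 \<le> n" for n
  proof -
    have "L ^ n \<le> root n (a n) ^ n"
      using low[OF that] L0 by (rule power_mono)
    also have "\<dots> = a n"
      using that nonneg by (simp add: real_root_pow_pos2)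
    finally show ?thesis .
  qed
  have "(\<lambda>n. root n (a n)) \<longlonglongrightarrow> L"
  proof (rule order_tendstoI)
    fix y assume "y < L"
    then show "\<forall>\<^sub>F n in sequentially. y < root n (a n)"
      using low by (intro eventually_sequentiallyI[of 1]) (meson less_le_trans)
  next
    fix y assume "L < y"
    then obtain t where t: "L < t" "t < y" using dense by blast
    have t0: "0 < t" using t L0 by linarith
    obtain m where m: "1 \<le> m" "root m (a m) < t"
      using t(1) unfolding L_def by (subst (asm) cINF_less_iff[OF _ bdd]) auto
    have am: "a m \<le> t ^ m"
    proof -
      have "a m = root m (a m) ^ m" using m nonneg by (simp add: real_root_pow_pos2)
      also have "\<dots> \<le> t ^ m" using m nonneg by (intro power_mono) auto
      finally show ?thesis .
    qed
    have iter: "a (m * q + r) \<le> t ^ (m * q) * a r" for q r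
    proof (induction q)
      case (Suc q)
      have "a (m * Suc q + r) = a (m + (m * q + r))" by (simp add: algebra_simps)
      also have "\<dots> \<le> a m * a (m * q + r)" by (rule submult)
      also have "\<dots> \<le> t ^ m * (t ^ (m * q) * a r)"
        using Suc am nonneg t0 by (intro mult_mono) auto
      finally show ?case by (simp add: power_add algebra_simps)
    qed simp
    \<comment> \<open>The sum dominates the contribution of every possible remainder; the added 1
      makes \<open>C\<close> positive even if all these terms vanish, so that
      \<open>root n C\<close> tends to 1.\<close>
    define C where "C = (\<Sum>r<m. a r / t ^ r) + 1"
    have C: "0 < C" unfolding C_def using nonneg t0
      by (intro add_nonneg_pos sum_nonneg) auto
    have bound: "root n (a n) \<le> t * root n C" if "1 \<le> n" for n
    proof -
      define r where "r = n mod m"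
      have n: "n = m * (n div m) + r" unfolding r_def by simp
      have "r < m" unfolding r_def using m by simp
      have "a n \<le> t ^ (m * (n div m)) * a r" using iter n by metis
      also have "\<dots> = t ^ n * (a r / t ^ r)"
        using t0 by (subst (2) n) (simp add: power_add)
      also have "a r / t ^ r \<le> C"
      proof -
        have "a r / t ^ r \<le> (\<Sum>r<m. a r / t ^ r)"
          using \<open>r < m\<close> nonneg t0 by (intro member_le_sum) auto
        then show ?thesis unfolding C_def by simp
      qed
      finally have "a n \<le> t ^ n * C" using t0 by simp
      then have "root n (a n) \<le> root n (t ^ n * C)" using that by simp
      also have "\<dots> = t * root n C"
        using that t0 by (simp add: real_root_mult real_root_power_cancel)
      finally show ?thesis .
    qed
    have "(\<lambda>n. t * root n C) \<longlonglongrightarrow> t * 1"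
      by (intro tendsto_mult tendsto_const LIMSEQ_root_const C)
    then have "\<forall>\<^sub>F n in sequentially. t * root n C < y"
      using t(2) by (auto dest: order_tendstoD)
    then show "\<forall>\<^sub>F n in sequentially. root n (a n) < y"
      using eventually_ge_at_top[of 1] by eventually_elim (use bound in force)
  qed
  then show ?thesis using L0 pow that by blast
qed

text \<open>Absorbs the constant \<open>C\<close>: if \<open>y < x\<close>, the powers of
  \<open>x / y\<close> would be unbounded, yet all of them are at most \<open>C / x\<close>.\<close>

lemma power_growth_le:
  fixes x y C :: real
  assumes "0 \<le> x" "0 < y" and le: "\<And>k. x ^ Suc k \<le> C * y ^ k"
  shows "x \<le> y"
proof (rule ccontr)
  assume "\<not> x \<le> y"
  then have xy: "y < x" by simp
  then have "0 < x" using assms by simp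
  have "1 < x / y" using xy assms by simp
  then obtain k where k: "C / x < (x / y) ^ k" using real_arch_pow by blast
  have "x * x ^ k \<le> C * y ^ k" using le[of k] by simp
  then have "(x / y) ^ k \<le> C / x"
    using \<open>0 < x\<close> assms by (simp add: power_divide field_simps)
  then show False using k by simp
qed

section \<open>Families of rectangles and the adaptive product\<close>

text \<open>Size and volume see a rectangle or a rank-one term only through its two side lengths, so
  the abstract part keeps just these.\<close>

definition volume :: "real \<Rightarrow> nat set \<Rightarrow> (nat \<Rightarrow> nat) \<Rightarrow> (nat \<Rightarrow> nat) \<Rightarrow> real" where
  "volume \<alpha> I u v = (\<Sum>k\<in>I. real (u k) powr \<alpha> * real (v k) powr (1 - \<alpha>))"

text \<open>The l^p norm (a quasi-norm below 1) of the pair \<open>(a, b)\<close> with p =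
  \<open>\<epsilon>\<close>. It is homogeneous of degree one, so it can stand in for
  \<open>a + b\<close>.\<close>

definition potential :: "real \<Rightarrow> real \<Rightarrow> real \<Rightarrow> real" where
  "potential \<epsilon> a b = (a powr \<epsilon> + b powr \<epsilon>) powr (1 / \<epsilon>)"

lemma potential_ge:
  assumes "0 < \<epsilon>" "0 < a" "0 < b"
  shows "a \<le> potential \<epsilon> a b" "b \<le> potential \<epsilon> a b"
proof -
  have "(a powr \<epsilon>) powr (1 / \<epsilon>) \<le> potential \<epsilon> a b"
    "(b powr \<epsilon>) powr (1 / \<epsilon>) \<le> potential \<epsilon> a b"
    unfolding potential_def using assms by (auto intro!: powr_mono2)
  then show "a \<le> potential \<epsilon> a b" "b \<le> potential \<epsilon> a b"
    using assms by (simp_all add: powr_powr)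
qed

text \<open>The left-hand side is, up to the factor \<open>potential \<epsilon> a b\<close>, the weighted power mean of
  \<open>u\<close> and \<open>v\<close> with exponent \<open>\<epsilon>\<close>, which tends to the weighted geometric mean.\<close>

lemma potential_mult_le:
  fixes a b u v \<epsilon> L :: real
  defines "w \<equiv> a powr \<epsilon> / (a powr \<epsilon> + b powr \<epsilon>)"
  assumes \<epsilon>: "0 < \<epsilon>" "\<epsilon> * L \<le> 1" and ab: "0 < a" "0 < b"
    and u: "1 \<le> u" "ln u \<le> L" and v: "1 \<le> v" "ln v \<le> L"
  shows "potential \<epsilon> (a * u) (b * v)
    \<le> potential \<epsilon> a b * (exp (\<epsilon> * L\<^sup>2) * (u powr w * v powr (1 - w)))"
proof -
  have s: "0 < a powr \<epsilon> + b powr \<epsilon>" using ab by (simp add: add_pos_pos)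
  have w: "0 \<le> w" "w \<le> 1" unfolding w_def using s by (auto simp: divide_simps)
  have L: "0 \<le> L" using u ln_ge_zero[OF u(1)] by linarith
  \<comment> \<open>This is \<open>exp x \<le> 1 + x + x^2\<close> on the unit interval at
    \<open>x = \<epsilon> * ln z\<close>; here \<open>\<epsilon> * L \<le> 1\<close> enters.\<close>
  have ex: "z powr \<epsilon> \<le> 1 + \<epsilon> * ln z + (\<epsilon> * L)\<^sup>2" if z: "1 \<le> z" "ln z \<le> L" for z
  proof -
    have "0 \<le> \<epsilon> * ln z" using z \<epsilon> by simp
    moreover have zL: "\<epsilon> * ln z \<le> \<epsilon> * L" using z \<epsilon> by simp
    ultimately have "exp (\<epsilon> * ln z) \<le> 1 + \<epsilon> * ln z + (\<epsilon> * ln z)\<^sup>2"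
      using \<epsilon>(2) by (intro exp_bound) linarith+
    also have "(\<epsilon> * ln z)\<^sup>2 \<le> (\<epsilon> * L)\<^sup>2"
      using \<open>0 \<le> \<epsilon> * ln z\<close> zL by (intro power_mono) auto
    finally show ?thesis using z by (simp add: powr_def)
  qed
  have "(a * u) powr \<epsilon> + (b * v) powr \<epsilon> = a powr \<epsilon> * u powr \<epsilon> + b powr \<epsilon> * v powr \<epsilon>"
    using ab u v by (simp add: powr_mult)
  also have "\<dots> = (a powr \<epsilon> + b powr \<epsilon>) * (w * u powr \<epsilon> + (1 - w) * v powr \<epsilon>)"
  proof -
    have "(a powr \<epsilon> + b powr \<epsilon>) * w = a powr \<epsilon>" unfolding w_def using s by simp
    moreover from this have "(a powr \<epsilon> + b powr \<epsilon>) * (1 - w) = b powr \<epsilon>"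
      by (simp add: right_diff_distrib)
    ultimately show ?thesis by (simp only: distrib_left mult.assoc[symmetric])
  qed
  finally have split: "(a * u) powr \<epsilon> + (b * v) powr \<epsilon>
    = (a powr \<epsilon> + b powr \<epsilon>) * (w * u powr \<epsilon> + (1 - w) * v powr \<epsilon>)" .
  have mean0: "0 \<le> w * u powr \<epsilon> + (1 - w) * v powr \<epsilon>" using w by simp
  have "w * u powr \<epsilon> + (1 - w) * v powr \<epsilon>
    \<le> w * (1 + \<epsilon> * ln u + (\<epsilon> * L)\<^sup>2) + (1 - w) * (1 + \<epsilon> * ln v + (\<epsilon> * L)\<^sup>2)"
    using ex u v w by (intro add_mono mult_left_mono) auto
  \<comment> \<open>The quadratic errors carry weights \<open>w\<close> and \<open>1 - w\<close>,
    which add up to one; pulling out \<open>\<epsilon>\<close> leaves an error linear in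
    \<open>\<epsilon>\<close>.\<close>
  also have "\<dots> = 1 + \<epsilon> * (w * ln u + (1 - w) * ln v + \<epsilon> * L\<^sup>2)"
    by (simp add: algebra_simps power2_eq_square)
  \<comment> \<open>Back to an exponential, so that the outer power \<open>1 / \<epsilon>\<close>
    cancels the factor \<open>\<epsilon>\<close> and leaves the geometric mean times
    \<open>exp (\<epsilon> * L^2)\<close>.\<close>
  also have "\<dots> \<le> exp (\<epsilon> * (w * ln u + (1 - w) * ln v + \<epsilon> * L\<^sup>2))"
    by (rule exp_ge_add_one_self)
  finally have "(w * u powr \<epsilon> + (1 - w) * v powr \<epsilon>) powr (1 / \<epsilon>)
    \<le> exp (\<epsilon> * (w * ln u + (1 - w) * ln v + \<epsilon> * L\<^sup>2)) powr (1 / \<epsilon>)"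
    using mean0 \<epsilon> by (intro powr_mono2) auto
  also have "\<dots> = exp (w * ln u + (1 - w) * ln v + \<epsilon> * L\<^sup>2)"
    using \<epsilon> by (simp add: powr_def)
  also have "\<dots> = exp (\<epsilon> * L\<^sup>2) * (u powr w * v powr (1 - w))"
    using u v by (simp add: powr_def exp_add)
  finally show ?thesis
    unfolding potential_def split using s mean0
    by (subst powr_mult) (auto intro!: mult_left_mono)
qed

text \<open>Index sets are sets of naturals, so the dependent pairs that index an adaptive product
  are encoded by \<open>prod_encode\<close>. This turns sums over the product back into iterated
  sums.\<close>

lemma sum_prod_encode_Sigma:
  assumes "finite I" "\<And>k. k \<in> I \<Longrightarrow> finite (J k)"
  shows "(\<Sum>x\<in>prod_encode ` Sigma I J. f (fst (prod_decode x)) (snd (prod_decode x)))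
    = (\<Sum>k\<in>I. \<Sum>l\<in>J k. f k l)"
  using assms by (subst sum.reindex) (auto simp: inj_prod_encode sum.Sigma split_def)

text \<open>\<open>P n I u v\<close> says that the \<open>n\<close>-th Kronecker power has an admissible family indexed by \<open>I\<close>
  whose members have side lengths \<open>u k\<close> and \<open>v k\<close>. In \<open>adaptive\<close>, the family multiplied onto
  a member may depend on that member.\<close>

locale rectangle_families =
  fixes P :: "nat \<Rightarrow> nat set \<Rightarrow> (nat \<Rightarrow> nat) \<Rightarrow> (nat \<Rightarrow> nat) \<Rightarrow> bool" and D :: nat
  assumes fin: "P n I u v \<Longrightarrow> finite I"
    and pos: "P n I u v \<Longrightarrow> k \<in> I \<Longrightarrow> 0 < u k \<and> 0 < v k"
    and bound: "P n I u v \<Longrightarrow> k \<in> I \<Longrightarrow> u k \<le> D ^ n \<and> v k \<le> D ^ n"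
    and D_pos: "0 < D"
    and ex: "\<exists>I u v. P n I u v"
    and adaptive: "P n I u v \<Longrightarrow> (\<And>k. k \<in> I \<Longrightarrow> P m (J k) (u' k) (v' k)) \<Longrightarrow>
      P (n + m) (prod_encode ` Sigma I J)
        (\<lambda>x. u (fst (prod_decode x)) * u' (fst (prod_decode x)) (snd (prod_decode x)))
        (\<lambda>x. v (fst (prod_decode x)) * v' (fst (prod_decode x)) (snd (prod_decode x)))"
begin

section \<open>Minimum size and infimal volume of abstract families\<close>

definition S :: "nat \<Rightarrow> nat" where
  "S n = (LEAST s. \<exists>I u v. P n I u v \<and> s = (\<Sum>k\<in>I. u k + v k))"

definition V :: "real \<Rightarrow> nat \<Rightarrow> real" where
  "V \<alpha> n = Inf {volume \<alpha> I u v | I u v. P n I u v}"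

lemma S_le: "P n I u v \<Longrightarrow> S n \<le> (\<Sum>k\<in>I. u k + v k)"
  unfolding S_def by (rule Least_le) blast

lemma S_attained: obtains I u v where "P n I u v" "S n = (\<Sum>k\<in>I. u k + v k)"
  using LeastI_ex[of "\<lambda>s. \<exists>I u v. P n I u v \<and> s = (\<Sum>k\<in>I. u k + v k)"] ex
  unfolding S_def by blast

lemma volume_nonneg: "0 \<le> volume \<alpha> I u v"
  unfolding volume_def by (intro sum_nonneg) auto

lemma V_nonneg: "0 \<le> V \<alpha> n"
  unfolding V_def using ex[of n] by (intro cInf_greatest) (auto simp: volume_nonneg)

lemma V_le: "P n I u v \<Longrightarrow> V \<alpha> n \<le> volume \<alpha> I u v"
  unfolding V_def by (intro cInf_lower) (auto intro!: bdd_belowI[of _ 0] simp: volume_nonneg)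

lemma V_less:
  assumes "V \<alpha> n < c"
  obtains I u v where "P n I u v" "volume \<alpha> I u v < c"
  using cInf_lessD[OF _ assms[unfolded V_def]] ex[of n] by auto

text \<open>A constant choice in \<open>adaptive\<close> gives the ordinary tensor product of two
  optimal families; \<open>u * u' + v * v'\<close> is \<open>(u + v) * (u' + v')\<close> without the
  nonnegative cross terms.\<close>

lemma S_submult: "S (m + n) \<le> S m * S n"
proof -
  obtain I u v where 1: "P m I u v" "S m = (\<Sum>k\<in>I. u k + v k)" by (rule S_attained)
  obtain J u' v' where 2: "P n J u' v'" "S n = (\<Sum>k\<in>J. u' k + v' k)" by (rule S_attained)
  have "S (m + n) \<le> (\<Sum>k\<in>I. \<Sum>l\<in>J. u k * u' l + v k * v' l)"
    using S_le[OF adaptive[OF 1(1) 2(1)]] fin[OF 1(1)] fin[OF 2(1)]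
    by (subst (asm) sum_prod_encode_Sigma[where f = "\<lambda>k l. u k * u' l + v k * v' l"]) auto
  also have "\<dots> \<le> (\<Sum>k\<in>I. \<Sum>l\<in>J. (u k + v k) * (u' l + v' l))"
    by (intro sum_mono) (simp add: algebra_simps)
  also have "\<dots> = S m * S n" using 1 2 by (simp add: sum_product)
  finally show ?thesis .
qed

text \<open>Volume is exactly multiplicative under tensor products. Since \<open>V\<close> is only
  an infimum, families within \<open>e\<close> of it are multiplied and \<open>e\<close> tends to 0
  from above.\<close>

lemma V_submult: "V \<alpha> (m + n) \<le> V \<alpha> m * V \<alpha> n"
proof -
  have le: "V \<alpha> (m + n) \<le> (V \<alpha> m + e) * (V \<alpha> n + e)" if e: "0 < e" for e
  proof -
    obtain I u v where 1: "P m I u v" "volume \<alpha> I u v < V \<alpha> m + e"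
      using V_less[of \<alpha> m "V \<alpha> m + e"] e by auto
    obtain J u' v' where 2: "P n J u' v'" "volume \<alpha> J u' v' < V \<alpha> n + e"
      using V_less[of \<alpha> n "V \<alpha> n + e"] e by auto
    have "V \<alpha> (m + n) \<le> (\<Sum>k\<in>I. \<Sum>l\<in>J.
        real (u k * u' l) powr \<alpha> * real (v k * v' l) powr (1 - \<alpha>))"
      using V_le[OF adaptive[OF 1(1) 2(1)], of \<alpha>] fin[OF 1(1)] fin[OF 2(1)]
      unfolding volume_def
      by (subst (asm) sum_prod_encode_Sigma[where
            f = "\<lambda>k l. real (u k * u' l) powr \<alpha> * real (v k * v' l) powr (1 - \<alpha>)"]) auto
    also have "\<dots> = volume \<alpha> I u v * volume \<alpha> J u' v'"
      unfolding volume_def sum_product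
      by (intro sum.cong refl) (simp add: powr_mult mult_ac)
    also have "\<dots> \<le> (V \<alpha> m + e) * (V \<alpha> n + e)"
      using 1(2) 2(2) volume_nonneg V_nonneg e by (intro mult_mono) (auto intro: add_nonneg_nonneg less_imp_le)
    finally show ?thesis .
  qed
  have "((\<lambda>e. (V \<alpha> m + e) * (V \<alpha> n + e)) \<longlongrightarrow> (V \<alpha> m + 0) * (V \<alpha> n + 0)) (at_right 0)"
    by (intro tendsto_intros)
  then have "V \<alpha> (m + n) \<le> (V \<alpha> m + 0) * (V \<alpha> n + 0)"
    by (rule tendsto_lowerbound)
      (auto simp: eventually_at_right_less le intro!: eventually_mono[OF eventually_at_right_less[of 0]])
  then show ?thesis by simp
qed

section \<open>Growth rates and the easy inequality\<close>

definition \<sigma> :: real where "\<sigma> = lim (\<lambda>n. root n (real (S n)))"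

definition \<sigma>\<^sub>\<alpha> :: "real \<Rightarrow> real" where "\<sigma>\<^sub>\<alpha> \<alpha> = lim (\<lambda>n. root n (V \<alpha> n))"

text \<open>\<open>fekete_root\<close> supplies the convergence behind \<open>lim\<close>. The bound
  \<open>\<sigma>_power_le\<close> later allows \<open>\<sigma>\<close> to be estimated from a
  family at any single level.\<close>

lemma \<sigma>_props:
  shows \<sigma>_LIMSEQ: "(\<lambda>n. root n (real (S n))) \<longlonglongrightarrow> \<sigma>" and \<sigma>_nonneg: "0 \<le> \<sigma>"
    and \<sigma>_power_le: "1 \<le> n \<Longrightarrow> \<sigma> ^ n \<le> real (S n)"
proof -
  have "real (S (m + n)) \<le> real (S m) * real (S n)" for m n
    using S_submult[of m n] by (metis of_nat_le_iff of_nat_mult)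
  then obtain L where "(\<lambda>n. root n (real (S n))) \<longlonglongrightarrow> L" "0 \<le> L"
    "\<And>n. 1 \<le> n \<Longrightarrow> L ^ n \<le> real (S n)"
    by (rule fekete_root[rotated]) auto
  then show "(\<lambda>n. root n (real (S n))) \<longlonglongrightarrow> \<sigma>" "0 \<le> \<sigma>" "1 \<le> n \<Longrightarrow> \<sigma> ^ n \<le> real (S n)"
    unfolding \<sigma>_def by (auto dest: limI)
qed

lemma \<sigma>\<^sub>\<alpha>_props:
  shows \<sigma>\<^sub>\<alpha>_LIMSEQ: "(\<lambda>n. root n (V \<alpha> n)) \<longlonglongrightarrow> \<sigma>\<^sub>\<alpha> \<alpha>" and \<sigma>\<^sub>\<alpha>_nonneg: "0 \<le> \<sigma>\<^sub>\<alpha> \<alpha>"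
proof -
  obtain L where "(\<lambda>n. root n (V \<alpha> n)) \<longlonglongrightarrow> L" "0 \<le> L"
    by (rule fekete_root[OF V_nonneg V_submult])
  then show "(\<lambda>n. root n (V \<alpha> n)) \<longlonglongrightarrow> \<sigma>\<^sub>\<alpha> \<alpha>" "0 \<le> \<sigma>\<^sub>\<alpha> \<alpha>"
    unfolding \<sigma>\<^sub>\<alpha>_def by (auto dest: limI)
qed

lemma V_le_S:
  assumes "\<alpha> \<in> {0..1}"
  shows "V \<alpha> n \<le> real (S n)"
proof -
  obtain I u v where 1: "P n I u v" "S n = (\<Sum>k\<in>I. u k + v k)" by (rule S_attained)
  have "V \<alpha> n \<le> volume \<alpha> I u v" using 1(1) by (rule V_le)
  also have "\<dots> \<le> (\<Sum>k\<in>I. real (u k + v k))"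
    unfolding volume_def
  proof (rule sum_mono)
    fix k assume "k \<in> I"
    then have "0 < u k + v k" using pos 1 by fastforce
    have "real (u k) powr \<alpha> * real (v k) powr (1 - \<alpha>)
      \<le> real (u k + v k) powr \<alpha> * real (u k + v k) powr (1 - \<alpha>)"
      using assms by (intro mult_mono powr_mono2) auto
    also have "\<dots> = real (u k + v k)"
      using \<open>0 < u k + v k\<close> by (simp flip: powr_add)
    finally show "real (u k) powr \<alpha> * real (v k) powr (1 - \<alpha>) \<le> real (u k + v k)" .
  qed
  finally show ?thesis using 1 by simp
qed

lemma \<sigma>\<^sub>\<alpha>_le_\<sigma>: "\<alpha> \<in> {0..1} \<Longrightarrow> \<sigma>\<^sub>\<alpha> \<alpha> \<le> \<sigma>"
  by (rule LIMSEQ_le[OF \<sigma>\<^sub>\<alpha>_LIMSEQ \<sigma>_LIMSEQ])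
    (auto intro!: exI[of _ 1] simp: V_le_S)

section \<open>The hard inequality\<close>

lemma ln_bound:
  assumes "P n I u v" "k \<in> I"
  shows "ln (real (u k)) \<le> real n * ln (real D)" "ln (real (v k)) \<le> real n * ln (real D)"
proof -
  have "real (u k) \<le> real D ^ n" "real (v k) \<le> real D ^ n"
    using bound[OF assms] by (metis of_nat_le_iff of_nat_power)+
  moreover have "0 < real (u k)" "0 < real (v k)" using pos[OF assms] by auto
  ultimately have "ln (real (u k)) \<le> ln (real D ^ n)" "ln (real (v k)) \<le> ln (real D ^ n)"
    using D_pos by (auto simp: ln_le_cancel_iff)
  then show "ln (real (u k)) \<le> real n * ln (real D)" "ln (real (v k)) \<le> real n * ln (real D)"
    using D_pos by (simp_all add: ln_realpow)
qed

text \<open>Changing the exponent shifts the logarithm of a summand by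
  \<open>(\<beta> - \<alpha>) * (ln u - ln v)\<close>, and both logarithms lie between 0 and
  \<open>n * ln D\<close>. The loss per level is thus \<open>D powr \<delta>\<close>, whatever
  \<open>n\<close> is.\<close>

lemma volume_perturb:
  assumes P: "P n I u v" and \<delta>: "\<bar>\<beta> - \<alpha>\<bar> \<le> \<delta>"
  shows "volume \<beta> I u v \<le> volume \<alpha> I u v * (real D powr \<delta>) ^ n"
  unfolding volume_def sum_distrib_right
proof (rule sum_mono)
  fix k assume k: "k \<in> I"
  have 1: "0 \<le> ln (real (u k))" "0 \<le> ln (real (v k))" using pos[OF P k] by auto
  have "(\<beta> - \<alpha>) * (ln (real (u k)) - ln (real (v k)))
    \<le> \<bar>\<beta> - \<alpha>\<bar> * \<bar>ln (real (u k)) - ln (real (v k))\<bar>"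
    by (metis abs_ge_self abs_mult)
  also have "\<dots> \<le> \<delta> * (real n * ln (real D))"
    using ln_bound[OF P k] 1 \<delta> by (intro mult_mono) auto
  finally have "\<beta> * ln (real (u k)) + (1 - \<beta>) * ln (real (v k))
    \<le> \<alpha> * ln (real (u k)) + (1 - \<alpha>) * ln (real (v k)) + real n * (\<delta> * ln (real D))"
    by (simp add: algebra_simps)
  then have "exp (\<beta> * ln (real (u k)) + (1 - \<beta>) * ln (real (v k)))
    \<le> exp (\<alpha> * ln (real (u k)) + (1 - \<alpha>) * ln (real (v k)) + real n * (\<delta> * ln (real D)))"
    by simp
  then show "real (u k) powr \<beta> * real (v k) powr (1 - \<beta>)
    \<le> real (u k) powr \<alpha> * real (v k) powr (1 - \<alpha>) * (real D powr \<delta>) ^ n"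
    using pos[OF P k] D_pos by (simp add: powr_def exp_add exp_of_nat_mult)
qed

text \<open>The adaptive product at work: one level \<open>n\<close> that serves every weight
  suffices. Each factor multiplies the total potential by at most
  \<open>exp (\<epsilon> * L^2) * T\<close>; iterating removes the constants, and then
  \<open>\<epsilon>\<close> tends to 0 with \<open>n\<close> fixed.\<close>

lemma \<sigma>_power_le_of_volumes:
  assumes n: "1 \<le> n" and T: "0 < T"
    and vol: "\<And>w. w \<in> {0..1} \<Longrightarrow> \<exists>I u v. P n I u v \<and> volume w I u v \<le> T"
  shows "\<sigma> ^ n \<le> T"
proof -
  define L where "L = real n * ln (real D)"
  have L0: "0 \<le> L" unfolding L_def using D_pos by simp
  have le: "\<sigma> ^ n \<le> exp (\<epsilon> * L\<^sup>2) * T" if \<epsilon>: "0 < \<epsilon>" "\<epsilon> * L \<le> 1" for \<epsilon>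
  proof -
    define c where "c = exp (\<epsilon> * L\<^sup>2)"
    \<comment> \<open>Any starting family will do: its potential enters only through the constant
      \<open>C\<close>.\<close>
    obtain I0 u0 v0 where P0: "P n I0 u0 v0" using ex by blast
    define C where "C = (\<Sum>k\<in>I0. potential \<epsilon> (u0 k) (v0 k))"
    have grow: "\<exists>I u v. P (n * Suc k) I u v \<and>
      (\<Sum>i\<in>I. potential \<epsilon> (u i) (v i)) \<le> C * (c * T) ^ k" for k
    proof (induction k)
      case 0
      then show ?case using P0 unfolding C_def by auto
    next
      case (Suc k)
      then obtain I u v where IH: "P (n * Suc k) I u v"
        "(\<Sum>i\<in>I. potential \<epsilon> (u i) (v i)) \<le> C * (c * T) ^ k" by blast
      \<comment> \<open>Each member gets its own weight, namely the one for which
        \<open>potential_mult_le\<close> compares the new potential with a weighted geometric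
        mean.\<close>
      define w where "w i = real (u i) powr \<epsilon> / (real (u i) powr \<epsilon> + real (v i) powr \<epsilon>)" for i
      \<comment> \<open>If \<open>x + y = 0\<close>, the quotient is 0 and still lies in the
        interval, so families can be chosen for all \<open>i\<close>, not only for members of
        \<open>I\<close>.\<close>
      have "x / (x + y) \<in> {0..1}" if "0 \<le> x" "0 \<le> y" for x y :: real
        using that by (cases "x + y = 0") (auto simp: divide_le_eq_1)
      then have "w i \<in> {0..1}" for i unfolding w_def by simp
      then have "\<forall>i. \<exists>I u v. P n I u v \<and> volume (w i) I u v \<le> T" using vol by blast
      then obtain J u' v' where J: "\<And>i. P n (J i) (u' i) (v' i)"
        "\<And>i. volume (w i) (J i) (u' i) (v' i) \<le> T" by metis
      have step: "(\<Sum>l\<in>J i. potential \<epsilon> (real (u i * u' i l)) (real (v i * v' i l)))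
        \<le> potential \<epsilon> (u i) (v i) * (c * T)" if i: "i \<in> I" for i
      proof -
        have "(\<Sum>l\<in>J i. potential \<epsilon> (real (u i * u' i l)) (real (v i * v' i l)))
          \<le> (\<Sum>l\<in>J i. potential \<epsilon> (u i) (v i) *
              (c * (real (u' i l) powr w i * real (v' i l) powr (1 - w i))))"
        proof (rule sum_mono)
          fix l assume l: "l \<in> J i"
          show "potential \<epsilon> (real (u i * u' i l)) (real (v i * v' i l))
            \<le> potential \<epsilon> (u i) (v i) *
              (c * (real (u' i l) powr w i * real (v' i l) powr (1 - w i)))"
            unfolding c_def w_def of_nat_mult
            using pos[OF IH(1) i] pos[OF J(1) l] ln_bound[OF J(1) l] \<epsilon>
            by (intro potential_mult_le) (auto simp: L_def Suc_le_eq)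
        qed
        also have "\<dots> = potential \<epsilon> (u i) (v i) * (c * volume (w i) (J i) (u' i) (v' i))"
          unfolding volume_def by (simp add: sum_distrib_left)
        also have "\<dots> \<le> potential \<epsilon> (u i) (v i) * (c * T)"
          using J(2) by (intro mult_left_mono) (auto simp: c_def potential_def)
        finally show ?thesis .
      qed
      let ?u = "\<lambda>x. u (fst (prod_decode x)) * u' (fst (prod_decode x)) (snd (prod_decode x))"
      let ?v = "\<lambda>x. v (fst (prod_decode x)) * v' (fst (prod_decode x)) (snd (prod_decode x))"
      have "n * Suc (Suc k) = n * Suc k + n" by simp
      then have "P (n * Suc (Suc k)) (prod_encode ` Sigma I J) ?u ?v"
        using adaptive[OF IH(1) J(1)] by (simp only:)
      moreover have "(\<Sum>x\<in>prod_encode ` Sigma I J. potential \<epsilon> (real (?u x)) (real (?v x)))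
        \<le> C * (c * T) ^ Suc k"
      proof -
        have "(\<Sum>x\<in>prod_encode ` Sigma I J. potential \<epsilon> (real (?u x)) (real (?v x)))
          = (\<Sum>i\<in>I. \<Sum>l\<in>J i. potential \<epsilon> (real (u i * u' i l)) (real (v i * v' i l)))"
          using fin[OF IH(1)] fin[OF J(1)] by (rule sum_prod_encode_Sigma)
        also have "\<dots> \<le> (\<Sum>i\<in>I. potential \<epsilon> (u i) (v i) * (c * T))"
          by (intro sum_mono step)
        also have "\<dots> = (\<Sum>i\<in>I. potential \<epsilon> (u i) (v i)) * (c * T)"
          by (simp add: sum_distrib_right)
        also have "\<dots> \<le> C * (c * T) ^ k * (c * T)"
          using IH(2) T by (intro mult_right_mono) (auto simp: c_def)
        finally show ?thesis by (simp add: mult_ac)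
      qed
      ultimately show ?case
        by (intro exI[of _ "prod_encode ` Sigma I J"] exI[of _ ?u] exI[of _ ?v] conjI)
    qed
    \<comment> \<open>The exponents differ by one because the starting family is paid for by
      \<open>C\<close>; the factor 2 comes from bounding both sides of a rectangle by its potential.
      \<open>power_growth_le\<close> discards both constants.\<close>
    have "(\<sigma> ^ n) ^ Suc k \<le> (2 * C) * (c * T) ^ k" for k
    proof -
      obtain I u v where P: "P (n * Suc k) I u v"
        "(\<Sum>i\<in>I. potential \<epsilon> (u i) (v i)) \<le> C * (c * T) ^ k" using grow[of k] by blast
      have "(\<sigma> ^ n) ^ Suc k \<le> real (S (n * Suc k))"
        unfolding power_mult[symmetric] using n by (intro \<sigma>_power_le) (simp add: Suc_le_eq)
      also have "\<dots> \<le> (\<Sum>i\<in>I. real (u i) + real (v i))"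
        using S_le[OF P(1)] by (simp flip: of_nat_add of_nat_sum)
      also have "\<dots> \<le> (\<Sum>i\<in>I. 2 * potential \<epsilon> (u i) (v i))"
      proof (rule sum_mono)
        fix i assume "i \<in> I"
        then show "real (u i) + real (v i) \<le> 2 * potential \<epsilon> (u i) (v i)"
          using potential_ge[OF \<epsilon>(1), of "u i" "v i"] pos[OF P(1)] by fastforce
      qed
      finally show ?thesis using P(2) by (simp flip: sum_distrib_left)
    qed
    moreover have "0 < c * T" unfolding c_def using T by simp
    ultimately show ?thesis
      using \<sigma>_nonneg by (fold c_def) (intro power_growth_le[of "\<sigma> ^ n" "c * T" "2 * C"], auto)
  qed
  \<comment> \<open>\<open>L\<close> depends on \<open>n\<close> but not on
    \<open>\<epsilon>\<close>, so the condition \<open>\<epsilon> * L \<le> 1\<close> holds for all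
    small \<open>\<epsilon>\<close> and the error factor tends to 1.\<close>
  have "((\<lambda>\<epsilon>. exp (\<epsilon> * L\<^sup>2) * T) \<longlongrightarrow> exp (0 * L\<^sup>2) * T) (at_right 0)"
    by (intro tendsto_intros)
  moreover have "\<forall>\<^sub>F \<epsilon> in at_right 0. \<sigma> ^ n \<le> exp (\<epsilon> * L\<^sup>2) * T"
  proof -
    have "((\<lambda>\<epsilon>. \<epsilon> * L) \<longlongrightarrow> 0 * L) (at_right 0)" by (intro tendsto_intros)
    then have "\<forall>\<^sub>F \<epsilon> in at_right 0. \<epsilon> * L < 1" by (rule order_tendstoD) simp
    then show ?thesis using eventually_at_right_less[of 0]
      by eventually_elim (auto intro: le)
  qed
  ultimately have "\<sigma> ^ n \<le> exp (0 * L\<^sup>2) * T"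
    by (rule tendsto_lowerbound) simp
  then show ?thesis by simp
qed

lemma grid_approx:
  assumes "w \<in> {0..1}" "0 < (K::nat)"
  shows "\<exists>k\<in>{..K}. \<bar>w - real k / real K\<bar> \<le> 1 / real K"
proof
  let ?k = "nat \<lfloor>w * real K\<rfloor>"
  have w: "0 \<le> w * real K" "w * real K \<le> real K" using assms by (auto simp: mult_left_le_one_le)
  then show "?k \<in> {..K}" by (simp add: nat_le_iff floor_le_iff)
  have "\<bar>w * real K - real ?k\<bar> \<le> 1" using w by (simp add: of_nat_nat) linarith
  moreover have "w - real ?k / real K = (w * real K - real ?k) / real K"
    using assms by (simp add: field_simps)
  ultimately show "\<bar>w - real ?k / real K\<bar> \<le> 1 / real K"
    using assms by (simp add: divide_right_mono)
qed

text \<open>The level from which \<open>V \<alpha> n < t ^ n\<close> holds may depend on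
  \<open>\<alpha>\<close>. The finitely many grid points \<open>k / K\<close> have a common level,
  and any other weight is moved to a nearby grid point by \<open>volume_perturb\<close>.\<close>

lemma uniform_volumes:
  assumes t: "0 < t" "t < t'" and small: "\<And>\<alpha>. \<alpha> \<in> {0..1} \<Longrightarrow> \<sigma>\<^sub>\<alpha> \<alpha> < t"
  shows "\<exists>n\<ge>1. \<forall>w\<in>{0..1}. \<exists>I u v. P n I u v \<and> volume w I u v \<le> t' ^ n"
proof -
  \<comment> \<open>\<open>K\<close> can be fixed before \<open>n\<close>, since the loss
    \<open>D powr (1 / K)\<close> per level does not depend on \<open>n\<close>.\<close>
  have "(\<lambda>K. t * real D powr (1 / real K)) \<longlonglongrightarrow> t * real D powr 0"
    using D_pos by (intro tendsto_intros lim_1_over_n) auto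
  moreover have "t * real D powr 0 < t'" using t D_pos by simp
  ultimately have "\<forall>\<^sub>F K in sequentially. t * real D powr (1 / real K) < t'"
    by (rule order_tendstoD)
  then have "\<forall>\<^sub>F K in sequentially. t * real D powr (1 / real K) < t' \<and> 0 < K"
    using eventually_gt_at_top[of 0] by eventually_elim auto
  then obtain K where K: "t * real D powr (1 / real K) < t'" "0 < K"
    by (metis (mono_tags, lifting) eventually_happens trivial_limit_sequentially)
  have "\<forall>\<^sub>F n in sequentially. \<forall>k\<in>{..K}. root n (V (real k / real K) n) < t"
    using K by (intro eventually_ball_finite ballI order_tendstoD(2)[OF \<sigma>\<^sub>\<alpha>_LIMSEQ small]) auto
  then have "\<forall>\<^sub>F n in sequentially. 1 \<le> n \<and> (\<forall>k\<in>{..K}. root n (V (real k / real K) n) < t)"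
    using eventually_ge_at_top[of 1] by eventually_elim auto
  then obtain n where n: "1 \<le> n" "\<And>k. k \<le> K \<Longrightarrow> root n (V (real k / real K) n) < t"
    by (metis (mono_tags, lifting) eventually_happens trivial_limit_sequentially atMost_iff)
  have "\<exists>I u v. P n I u v \<and> volume w I u v \<le> t' ^ n" if w: "w \<in> {0..1}" for w
  proof -
    obtain k where k: "k \<le> K" "\<bar>w - real k / real K\<bar> \<le> 1 / real K"
      using grid_approx[OF w K(2)] by auto
    have "V (real k / real K) n = root n (V (real k / real K) n) ^ n"
      using n(1) V_nonneg by (simp add: real_root_pow_pos2)
    also have "\<dots> < t ^ n"
      using n(1) n(2)[OF k(1)] V_nonneg by (intro power_strict_mono) auto
    finally obtain I u v where I: "P n I u v" "volume (real k / real K) I u v < t ^ n"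
      by (rule V_less)
    have "volume w I u v \<le> volume (real k / real K) I u v * (real D powr (1 / real K)) ^ n"
      by (rule volume_perturb[OF I(1) k(2)])
    also have "\<dots> \<le> t ^ n * (real D powr (1 / real K)) ^ n"
      using I(2) by (intro mult_right_mono) auto
    also have "\<dots> = (t * real D powr (1 / real K)) ^ n" by (simp add: power_mult_distrib)
    also have "\<dots> \<le> t' ^ n" using K t by (intro power_mono) auto
    finally show ?thesis using I(1) by blast
  qed
  then show ?thesis using n(1) by blast
qed

theorem \<sigma>_eq_SUP: "\<sigma> = (SUP \<alpha>\<in>{0..1}. \<sigma>\<^sub>\<alpha> \<alpha>)"
proof (rule antisym)
  have bdd: "bdd_above (\<sigma>\<^sub>\<alpha> ` {0..1})"
    by (rule bdd_aboveI[of _ \<sigma>]) (auto simp: \<sigma>\<^sub>\<alpha>_le_\<sigma>)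
  show "(SUP \<alpha>\<in>{0..1}. \<sigma>\<^sub>\<alpha> \<alpha>) \<le> \<sigma>"
    by (rule cSUP_least) (auto simp: \<sigma>\<^sub>\<alpha>_le_\<sigma>)
  show "\<sigma> \<le> (SUP \<alpha>\<in>{0..1}. \<sigma>\<^sub>\<alpha> \<alpha>)"
  proof (rule dense_ge)
    fix t' assume "(SUP \<alpha>\<in>{0..1}. \<sigma>\<^sub>\<alpha> \<alpha>) < t'"
    \<comment> \<open>The gap between \<open>t\<close> and \<open>t'\<close> is the room in which
      \<open>uniform_volumes\<close> absorbs the loss from the grid.\<close>
    then obtain t where t: "(SUP \<alpha>\<in>{0..1}. \<sigma>\<^sub>\<alpha> \<alpha>) < t" "t < t'" using dense by blast
    have small: "\<sigma>\<^sub>\<alpha> \<alpha> < t" if "\<alpha> \<in> {0..1}" for \<alpha>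
      using cSUP_upper[OF that bdd] t(1) by linarith
    have t0: "0 < t" using small[of 0] \<sigma>\<^sub>\<alpha>_nonneg[of 0] by simp
    obtain n where n: "1 \<le> n" "\<And>w. w \<in> {0..1} \<Longrightarrow> \<exists>I u v. P n I u v \<and> volume w I u v \<le> t' ^ n"
      using uniform_volumes[OF t0 t(2) small] by blast
    have "\<sigma> ^ n \<le> t' ^ n"
      using n t0 t(2) by (intro \<sigma>_power_le_of_volumes) auto
    then show "\<sigma> \<le> t'"
      using n(1) t0 t(2) by (simp add: power_mono_iff \<sigma>_nonneg)
  qed
qed

end

section \<open>Kronecker products of matrices and of index sets\<close>

text \<open>For \<open>B\<close> below \<open>d\<close> this is the product of \<open>A\<close> and
  \<open>B\<close> under the pairing \<open>i * d + j\<close> by which \<open>kronecker\<close>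
  indexes; the form with \<open>div\<close> and \<open>mod\<close> matches
  \<open>index_kronecker\<close>.\<close>

definition block_set :: "nat \<Rightarrow> nat set \<Rightarrow> nat set \<Rightarrow> nat set" where
  "block_set d A B = {i. i div d \<in> A \<and> i mod d \<in> B}"

lemma block_set_eq_image:
  assumes "B \<subseteq> {..<d}"
  shows "block_set d A B = (\<lambda>(i, j). i * d + j) ` (A \<times> B)"
proof (intro Set.set_eqI iffI)
  fix x assume "x \<in> block_set d A B"
  then show "x \<in> (\<lambda>(i, j). i * d + j) ` (A \<times> B)"
    by (intro image_eqI[of _ _ "(x div d, x mod d)"]) (auto simp: block_set_def)
next
  fix x assume "x \<in> (\<lambda>(i, j). i * d + j) ` (A \<times> B)"
  then obtain i j where "i \<in> A" "j \<in> B" "x = i * d + j" by auto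
  moreover from this have "j < d" using assms by auto
  ultimately show "x \<in> block_set d A B" by (simp add: block_set_def)
qed

lemma card_block_set:
  assumes "B \<subseteq> {..<d}"
  shows "card (block_set d A B) = card A * card B"
proof -
  have "inj_on (\<lambda>(i, j). i * d + j) (A \<times> B)"
  proof (rule inj_onI, clarify)
    fix i j i' j' assume "j \<in> B" "j' \<in> B" and eq: "i * d + j = i' * d + j'"
    then have "j < d" "j' < d" using assms by auto
    then have "(i * d + j) div d = i" "(i' * d + j') div d = i'"
      "(i * d + j) mod d = j" "(i' * d + j') mod d = j'" by simp_all
    then show "i = i' \<and> j = j'" using eq by metis
  qed
  then show ?thesis
    unfolding block_set_eq_image[OF assms] by (simp add: card_image card_cartesian_product)
qed

lemma div_mod_less_mult:
  fixes i m n :: nat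
  assumes "i < m * n"
  shows "i div n < m" "i mod n < n"
proof -
  show "i div n < m" using assms by (simp add: less_mult_imp_div_less)
  have "0 < n" using assms by (cases n) auto
  then show "i mod n < n" by simp
qed

lemma block_set_bounded:
  assumes "A \<subseteq> {..<m}" "B \<subseteq> {..<d}"
  shows "block_set d A B \<subseteq> {..<m * d}"
proof
  fix i assume "i \<in> block_set d A B"
  then have "i div d < m" "i mod d < d" using assms by (auto simp: block_set_def)
  then show "i \<in> {..<m * d}" by (simp add: div_less_iff_less_mult)
qed

lemma block_set_nonempty:
  assumes "A \<noteq> {}" "B \<noteq> {}" "B \<subseteq> {..<d}"
  shows "block_set d A B \<noteq> {}"
  using assms by (auto simp: block_set_eq_image)

lemma dim_kronecker [simp]:
  "dim_row (kronecker A B) = dim_row A * dim_row B"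
  "dim_col (kronecker A B) = dim_col A * dim_col B"
  by (simp_all add: kronecker_def)

lemma index_kronecker:
  "i < dim_row A * dim_row B \<Longrightarrow> j < dim_col A * dim_col B \<Longrightarrow>
    kronecker A B $$ (i, j)
      = A $$ (i div dim_row B, j div dim_col B) * B $$ (i mod dim_row B, j mod dim_col B)"
  by (simp add: kronecker_def)

lemma kronecker_one: "kronecker (1\<^sub>m 1) A = A"
  by (rule eq_matI) (auto simp: index_kronecker)

text \<open>An index of a triple product has the mixed-radix digits \<open>i div c div b\<close>,
  \<open>i div c mod b\<close> and \<open>i mod c\<close> for either bracketing, which is the
  content of \<open>kronecker_assoc\<close>.\<close>

lemma div_mod_mult_assoc:
  fixes i b c :: nat
  shows "i div (b * c) = i div c div b"
    "i mod (b * c) div c = i div c mod b" "i mod (b * c) mod c = i mod c"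
proof -
  show "i div (b * c) = i div c div b"
    using div_mult2_eq[of i c b] by (simp add: mult.commute)
  have "i mod (b * c) = c * (i div c mod b) + i mod c"
    using mod_mult2_eq[of i c b] by (simp add: mult.commute)
  then show "i mod (b * c) div c = i div c mod b" "i mod (b * c) mod c = i mod c"
    by (cases "c = 0"; simp)+
qed

lemma kronecker_assoc: "kronecker (kronecker A B) C = kronecker A (kronecker B C)"
proof (rule eq_matI)
  fix i j
  assume "i < dim_row (kronecker A (kronecker B C))" "j < dim_col (kronecker A (kronecker B C))"
  then have i: "i < dim_row A * dim_row B * dim_row C" and j: "j < dim_col A * dim_col B * dim_col C"
    by (simp_all add: mult.assoc)
  note i' = i[unfolded mult.assoc] and j' = j[unfolded mult.assoc]
  show "kronecker (kronecker A B) C $$ (i, j) = kronecker A (kronecker B C) $$ (i, j)"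
    using i j i' j' div_mod_less_mult[OF i] div_mod_less_mult[OF j]
      div_mod_less_mult[OF i'] div_mod_less_mult[OF j']
    by (simp add: index_kronecker div_mod_mult_assoc mult.assoc)
qed (simp_all add: mult.assoc)

lemma kronecker_power_add:
  "kronecker_power M (m + n) = kronecker (kronecker_power M m) (kronecker_power M n)"
  by (induction m) (simp_all add: kronecker_one[unfolded One_nat_def] kronecker_assoc)

lemma dim_kronecker_power:
  "dim_row (kronecker_power M n) = dim_row M ^ n" "dim_col (kronecker_power M n) = dim_col M ^ n"
  by (induction n) auto

text \<open>Without zero divisors an entry of the product is nonzero exactly when both factors are.
  Out of range, at least one quotient or remainder is out of range too.\<close>

lemma supp_kronecker:
  fixes A B :: "'a::semiring_1_no_zero_divisors mat"
  shows "(i, j) \<in> supp_mat (kronecker A B) \<longleftrightarrow>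
    (i div dim_row B, j div dim_col B) \<in> supp_mat A \<and>
    (i mod dim_row B, j mod dim_col B) \<in> supp_mat B"
proof (cases "i < dim_row A * dim_row B \<and> j < dim_col A * dim_col B")
  case True
  then show ?thesis
    using div_mod_less_mult[of i "dim_row A" "dim_row B"]
      div_mod_less_mult[of j "dim_col A" "dim_col B"]
    by (simp add: supp_mat_def index_kronecker)
next
  case False
  have "i < dim_row A * dim_row B \<and> j < dim_col A * dim_col B"
    if "i div dim_row B < dim_row A" "i mod dim_row B < dim_row B"
      "j div dim_col B < dim_col A" "j mod dim_col B < dim_col B"
    using that by (auto simp: div_less_iff_less_mult)
  then show ?thesis using False by (auto simp: supp_mat_def)
qed

lemma finite_supp_mat: "finite (supp_mat A)"
  by (rule finite_subset[of _ "{..<dim_row A} \<times> {..<dim_col A}"]) (auto simp: supp_mat_def)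

section \<open>From abstract families to decompositions, coverings and partitionings\<close>

definition max_dim :: "'a mat \<Rightarrow> nat" where
  "max_dim M = max 1 (max (dim_row M) (dim_col M))"

text \<open>Supplies the bound \<open>D ^ n\<close> of the locale. The 1 in \<open>max_dim\<close>
  keeps \<open>D\<close> positive when both dimensions are zero.\<close>

lemma dim_kronecker_power_le:
  "dim_row (kronecker_power M n) \<le> max_dim M ^ n" "dim_col (kronecker_power M n) \<le> max_dim M ^ n"
  unfolding dim_kronecker_power max_dim_def by (intro power_mono; simp)+

text \<open>\<open>R\<close> is the kind of family and \<open>f\<close> the length measure,
  \<open>nnz\<close> or \<open>card\<close>. The side lengths are prescribed on \<open>I\<close>
  only, so arbitrary values outside the index set do no harm.\<close>

definition profile ::
  "('a mat \<Rightarrow> nat set \<Rightarrow> (nat \<Rightarrow> 'b) \<Rightarrow> (nat \<Rightarrow> 'b) \<Rightarrow> bool) \<Rightarrow> ('b \<Rightarrow> nat) \<Rightarrow> 'a::semiring_1 mat \<Rightarrow>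
    nat \<Rightarrow> nat set \<Rightarrow> (nat \<Rightarrow> nat) \<Rightarrow> (nat \<Rightarrow> nat) \<Rightarrow> bool" where
  "profile R f M n I u v \<longleftrightarrow>
    (\<exists>A B. R (kronecker_power M n) I A B \<and> (\<forall>k\<in>I. u k = f (A k) \<and> v k = f (B k)))"

text \<open>As \<open>profile\<close> fixes \<open>u\<close> and \<open>v\<close> on
  \<open>I\<close> only, \<open>F\<close> is required to look at them only there; then side lengths
  can be traded for the actual vectors or sets.\<close>

lemma ex_profile_iff:
  assumes "\<And>I u v u' v'. (\<And>k. k \<in> I \<Longrightarrow> u k = u' k \<and> v k = v' k) \<Longrightarrow> F I u v = F I u' v'"
  shows "(\<exists>I u v. profile R f M n I u v \<and> s = F I u v) \<longleftrightarrow>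
    (\<exists>I A B. R (kronecker_power M n) I A B \<and> s = F I (\<lambda>k. f (A k)) (\<lambda>k. f (B k)))"
proof
  assume "\<exists>I u v. profile R f M n I u v \<and> s = F I u v"
  then obtain I u v A B where "s = F I u v" "R (kronecker_power M n) I A B"
    "\<And>k. k \<in> I \<Longrightarrow> u k = f (A k) \<and> v k = f (B k)"
    unfolding profile_def by blast
  moreover from this(3) have "F I u v = F I (\<lambda>k. f (A k)) (\<lambda>k. f (B k))" by (rule assms)
  ultimately show "\<exists>I A B. R (kronecker_power M n) I A B \<and> s = F I (\<lambda>k. f (A k)) (\<lambda>k. f (B k))"
    by auto
next
  assume "\<exists>I A B. R (kronecker_power M n) I A B \<and> s = F I (\<lambda>k. f (A k)) (\<lambda>k. f (B k))"
  then show "\<exists>I u v. profile R f M n I u v \<and> s = F I u v"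
    unfolding profile_def by fast
qed

text \<open>Reduces the locale to facts about single matrices and a product of two: the levels enter
  through \<open>kronecker_power_add\<close> and the dimensions of the powers.\<close>

lemma rectangle_families_profile:
  fixes M :: "'a::semiring_1 mat" and f :: "'b \<Rightarrow> nat"
  assumes finite: "\<And>X I A B. R X I A B \<Longrightarrow> finite I"
    and row: "\<And>X I A B k. R X I A B \<Longrightarrow> k \<in> I \<Longrightarrow> 0 < f (A k) \<and> f (A k) \<le> dim_row X"
    and col: "\<And>X I A B k. R X I A B \<Longrightarrow> k \<in> I \<Longrightarrow> 0 < f (B k) \<and> f (B k) \<le> dim_col X"
    and ex: "\<And>X. \<exists>I A B. R X I A B"
    and kron: "\<And>X Y I A B J A' B'.
      R X I A B \<Longrightarrow> (\<And>k. k \<in> I \<Longrightarrow> R Y (J k) (A' k) (B' k)) \<Longrightarrow>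
      \<exists>A'' B''. R (kronecker X Y) (prod_encode ` Sigma I J) A'' B'' \<and>
        (\<forall>k\<in>I. \<forall>l\<in>J k. f (A'' (prod_encode (k, l))) = f (A k) * f (A' k l) \<and>
          f (B'' (prod_encode (k, l))) = f (B k) * f (B' k l))"
  shows "rectangle_families (profile R f M) (max_dim M)"
proof
  fix n I u v assume "profile R f M n I u v"
  then obtain A B where AB: "R (kronecker_power M n) I A B"
    "\<And>k. k \<in> I \<Longrightarrow> u k = f (A k) \<and> v k = f (B k)"
    unfolding profile_def by blast
  then show "finite I" using finite by blast
  fix k assume k: "k \<in> I"
  show "0 < u k \<and> 0 < v k"
    using AB(2)[OF k] row[OF AB(1) k] col[OF AB(1) k] by simp
  show "u k \<le> max_dim M ^ n \<and> v k \<le> max_dim M ^ n"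
    using AB(2)[OF k] row[OF AB(1) k] col[OF AB(1) k] dim_kronecker_power_le[of M n] by auto
next
  show "0 < max_dim M" by (simp add: max_dim_def)
  show "\<exists>I u v. profile R f M n I u v" for n
    using ex[of "kronecker_power M n"] unfolding profile_def by fast
  fix n I u v m J u' v'
  assume "profile R f M n I u v" and J: "\<And>k. k \<in> I \<Longrightarrow> profile R f M m (J k) (u' k) (v' k)"
  then obtain A B where AB: "R (kronecker_power M n) I A B"
    "\<And>k. k \<in> I \<Longrightarrow> u k = f (A k) \<and> v k = f (B k)"
    unfolding profile_def by blast
  have "\<forall>k\<in>I. \<exists>A B. R (kronecker_power M m) (J k) A B \<and>
      (\<forall>l\<in>J k. u' k l = f (A l) \<and> v' k l = f (B l))"
    using J unfolding profile_def by blast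
  then obtain A' B' where AB': "\<And>k. k \<in> I \<Longrightarrow> R (kronecker_power M m) (J k) (A' k) (B' k)"
    "\<And>k l. k \<in> I \<Longrightarrow> l \<in> J k \<Longrightarrow> u' k l = f (A' k l) \<and> v' k l = f (B' k l)"
    by metis
  obtain A'' B'' where
    "R (kronecker_power M (n + m)) (prod_encode ` Sigma I J) A'' B''"
    "\<And>k l. k \<in> I \<Longrightarrow> l \<in> J k \<Longrightarrow> f (A'' (prod_encode (k, l))) = f (A k) * f (A' k l) \<and>
      f (B'' (prod_encode (k, l))) = f (B k) * f (B' k l)"
    using kron[where J = J and A' = A' and B' = B', OF AB(1) AB'(1)]
    unfolding kronecker_power_add by blast
  then show "profile R f M (n + m) (prod_encode ` Sigma I J)
      (\<lambda>x. u (fst (prod_decode x)) * u' (fst (prod_decode x)) (snd (prod_decode x)))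
      (\<lambda>x. v (fst (prod_decode x)) * v' (fst (prod_decode x)) (snd (prod_decode x)))"
    unfolding profile_def using AB(2) AB'(2) by (intro exI[of _ A''] exI[of _ B'']) auto
qed

text \<open>Sizes and volumes are written out so that one rule closes all three cases once their
  definitions are unfolded.\<close>

lemma lim_size_eq_SUP_lim_volume:
  assumes "rectangle_families (profile R f M) D"
  shows "lim (\<lambda>n. root n (real (LEAST s. \<exists>I A B. R (kronecker_power M n) I A B \<and>
        s = (\<Sum>k\<in>I. f (A k) + f (B k)))))
    = (SUP \<alpha>\<in>{0..1}. lim (\<lambda>n. root n (Inf {\<Sum>k\<in>I. real (f (A k)) powr \<alpha> * real (f (B k)) powr (1 - \<alpha>)
        | I A B. R (kronecker_power M n) I A B})))"
proof -
  interpret rectangle_families "profile R f M" D by (rule assms)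
  have S: "S n = (LEAST s. \<exists>I A B. R (kronecker_power M n) I A B \<and>
      s = (\<Sum>k\<in>I. f (A k) + f (B k)))" for n
    unfolding S_def by (subst ex_profile_iff[where F = "\<lambda>I u v. \<Sum>k\<in>I. u k + v k"]) simp_all
  have V: "V \<alpha> n = Inf {\<Sum>k\<in>I. real (f (A k)) powr \<alpha> * real (f (B k)) powr (1 - \<alpha>)
      | I A B. R (kronecker_power M n) I A B}" for \<alpha> n
    unfolding V_def volume_def
    using ex_profile_iff[where F = "\<lambda>I u v. \<Sum>k\<in>I. real (u k) powr \<alpha> * real (v k) powr (1 - \<alpha>)"
        and R = R and f = f and M = M and n = n]
    by (simp add: conj_commute)
  show ?thesis
    using \<sigma>_eq_SUP unfolding \<sigma>_def \<sigma>\<^sub>\<alpha>_def S V .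
qed

section \<open>Coverings and partitionings\<close>

text \<open>The quotients of a support position lie in some rectangle \<open>k\<close> of
  \<open>X\<close>. Every covering of \<open>Y\<close> reaches the whole support of
  \<open>Y\<close>, so the remainders are covered by the one chosen for that
  \<open>k\<close>.\<close>

lemma covering_kronecker:
  fixes X Y :: "'a::semiring_1_no_zero_divisors mat"
  assumes X: "is_covering X I A B" and Y: "\<And>k. k \<in> I \<Longrightarrow> is_covering Y (J k) (A' k) (B' k)"
  shows "is_covering (kronecker X Y) (prod_encode ` Sigma I J)
    (\<lambda>x. block_set (dim_row Y) (A (fst (prod_decode x))) (A' (fst (prod_decode x)) (snd (prod_decode x))))
    (\<lambda>x. block_set (dim_col Y) (B (fst (prod_decode x))) (B' (fst (prod_decode x)) (snd (prod_decode x))))"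
    (is "is_covering _ ?K ?A ?B")
  unfolding is_covering_def
proof (intro conjI ballI)
  show "finite ?K" using X Y by (auto simp: is_covering_def)
  fix x assume "x \<in> ?K"
  then obtain k l where x: "x = prod_encode (k, l)" and k: "k \<in> I" and l: "l \<in> J k" by auto
  have 1: "A k \<noteq> {}" "A k \<subseteq> {..<dim_row X}" "B k \<noteq> {}" "B k \<subseteq> {..<dim_col X}"
    using X k by (auto simp: is_covering_def)
  have 2: "A' k l \<noteq> {}" "A' k l \<subseteq> {..<dim_row Y}" "B' k l \<noteq> {}" "B' k l \<subseteq> {..<dim_col Y}"
    using Y[OF k] l by (auto simp: is_covering_def)
  show "?A x \<noteq> {}" "?B x \<noteq> {}" "?A x \<subseteq> {..<dim_row (kronecker X Y)}"
    "?B x \<subseteq> {..<dim_col (kronecker X Y)}"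
    using block_set_nonempty block_set_bounded 1 2 by (simp_all add: x)
next
  have "supp_mat X = (\<Union>k\<in>I. A k \<times> B k)" using X by (simp add: is_covering_def)
  then have X': "(i, j) \<in> supp_mat X \<longleftrightarrow> (\<exists>k\<in>I. i \<in> A k \<and> j \<in> B k)" for i j
    by auto
  have "supp_mat Y = (\<Union>l\<in>J k. A' k l \<times> B' k l)" if "k \<in> I" for k
    using Y[OF that] by (simp add: is_covering_def)
  then have Y': "(i, j) \<in> supp_mat Y \<longleftrightarrow> (\<exists>l\<in>J k. i \<in> A' k l \<and> j \<in> B' k l)" if "k \<in> I" for i j k
    using that by auto
  show "(\<Union>x\<in>?K. ?A x \<times> ?B x) = supp_mat (kronecker X Y)"
  proof (intro Set.set_eqI)
    fix p :: "nat \<times> nat"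
    obtain i j where p: "p = (i, j)" by (cases p)
    have "p \<in> (\<Union>x\<in>?K. ?A x \<times> ?B x) \<longleftrightarrow> (\<exists>k\<in>I. \<exists>l\<in>J k.
        i div dim_row Y \<in> A k \<and> i mod dim_row Y \<in> A' k l \<and>
        j div dim_col Y \<in> B k \<and> j mod dim_col Y \<in> B' k l)"
      by (auto simp: p block_set_def)
    also have "\<dots> \<longleftrightarrow> p \<in> supp_mat (kronecker X Y)"
      unfolding p supp_kronecker X' using Y' by blast
    finally show "p \<in> (\<Union>x\<in>?K. ?A x \<times> ?B x) \<longleftrightarrow> p \<in> supp_mat (kronecker X Y)" .
  qed
qed

text \<open>For disjointness, the quotients of a common position determine \<open>k\<close>, and
  then its remainders determine \<open>l\<close> within the partitioning chosen for
  \<open>k\<close>.\<close>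

lemma partitioning_kronecker:
  fixes X Y :: "'a::semiring_1_no_zero_divisors mat"
  assumes X: "is_partitioning X I A B"
    and Y: "\<And>k. k \<in> I \<Longrightarrow> is_partitioning Y (J k) (A' k) (B' k)"
  shows "is_partitioning (kronecker X Y) (prod_encode ` Sigma I J)
    (\<lambda>x. block_set (dim_row Y) (A (fst (prod_decode x))) (A' (fst (prod_decode x)) (snd (prod_decode x))))
    (\<lambda>x. block_set (dim_col Y) (B (fst (prod_decode x))) (B' (fst (prod_decode x)) (snd (prod_decode x))))"
    (is "is_partitioning _ ?K ?A ?B")
  unfolding is_partitioning_def
proof
  show "is_covering (kronecker X Y) ?K ?A ?B"
    using X Y by (intro covering_kronecker) (auto simp: is_partitioning_def)
  have dX: "k = k'" if "k \<in> I" "k' \<in> I" "i \<in> A k" "j \<in> B k" "i \<in> A k'" "j \<in> B k'" for i j k k'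
    using X that unfolding is_partitioning_def disjoint_family_on_def by blast
  have dY: "l = l'" if "k \<in> I" "l \<in> J k" "l' \<in> J k"
      "i \<in> A' k l" "j \<in> B' k l" "i \<in> A' k l'" "j \<in> B' k l'" for i j k l l'
    using Y[OF that(1)] that unfolding is_partitioning_def disjoint_family_on_def by blast
  show "disjoint_family_on (\<lambda>x. ?A x \<times> ?B x) ?K"
    unfolding disjoint_family_on_def
  proof (intro ballI impI, rule ccontr)
    fix x y assume "x \<in> ?K" "y \<in> ?K" and ne: "x \<noteq> y" and "?A x \<times> ?B x \<inter> ?A y \<times> ?B y \<noteq> {}"
    moreover obtain k l k' l' where xy: "x = prod_encode (k, l)" "y = prod_encode (k', l')"
        and kl: "k \<in> I" "l \<in> J k" "k' \<in> I" "l' \<in> J k'"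
      using \<open>x \<in> ?K\<close> \<open>y \<in> ?K\<close> by auto
    ultimately obtain i j where
      "i div dim_row Y \<in> A k" "i mod dim_row Y \<in> A' k l"
      "j div dim_col Y \<in> B k" "j mod dim_col Y \<in> B' k l"
      "i div dim_row Y \<in> A k'" "i mod dim_row Y \<in> A' k' l'"
      "j div dim_col Y \<in> B k'" "j mod dim_col Y \<in> B' k' l'"
      by (auto simp: block_set_def)
    then have "k = k' \<and> l = l'" using kl dX dY by metis
    then show False using ne xy by simp
  qed
qed

text \<open>One 1 by 1 rectangle per support position, so the minima and infima range over nonempty
  sets.\<close>

lemma partitioning_singletons:
  "is_partitioning X (prod_encode ` supp_mat X)
    (\<lambda>x. {fst (prod_decode x)}) (\<lambda>x. {snd (prod_decode x)})"
proof -
  have "finite (prod_encode ` supp_mat X)" by (simp add: finite_supp_mat)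
  then show ?thesis
    unfolding is_partitioning_def is_covering_def
    by (auto simp: disjoint_family_on_def supp_mat_def)
qed

lemma covering_card:
  assumes "is_covering X I A B" "k \<in> I"
  shows "0 < card (A k) \<and> card (A k) \<le> dim_row X" "0 < card (B k) \<and> card (B k) \<le> dim_col X"
proof -
  have "A k \<noteq> {}" "A k \<subseteq> {..<dim_row X}" "B k \<noteq> {}" "B k \<subseteq> {..<dim_col X}"
    using assms by (auto simp: is_covering_def)
  then show "0 < card (A k) \<and> card (A k) \<le> dim_row X" "0 < card (B k) \<and> card (B k) \<le> dim_col X"
    using card_mono[of "{..<dim_row X}" "A k"] card_mono[of "{..<dim_col X}" "B k"]
    by (auto simp: card_gt_0_iff intro: finite_subset)
qed

text \<open>\<open>R\<close> may be any notion between partitioning and covering that is closed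
  under the adaptive product, so both cases share one proof.\<close>

lemma rectangle_families_coverings:
  fixes N :: "'a::semiring_1_no_zero_divisors mat"
  assumes covering: "\<And>X I A B. R X I A B \<Longrightarrow> is_covering X I A B"
    and partitioning: "\<And>X I A B. is_partitioning X I A B \<Longrightarrow> R X I A B"
    and kron: "\<And>(X::'a mat) Y I A B J A' B'.
      R X I A B \<Longrightarrow> (\<And>k. k \<in> I \<Longrightarrow> R Y (J k) (A' k) (B' k)) \<Longrightarrow>
      R (kronecker X Y) (prod_encode ` Sigma I J)
        (\<lambda>x. block_set (dim_row Y) (A (fst (prod_decode x))) (A' (fst (prod_decode x)) (snd (prod_decode x))))
        (\<lambda>x. block_set (dim_col Y) (B (fst (prod_decode x))) (B' (fst (prod_decode x)) (snd (prod_decode x))))"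
  shows "rectangle_families (profile R card N) (max_dim N)"
proof (rule rectangle_families_profile)
  fix X I A B assume R: "R X I A B"
  then show "finite I" using covering is_covering_def by blast
  show "0 < card (A k) \<and> card (A k) \<le> dim_row X" "0 < card (B k) \<and> card (B k) \<le> dim_col X"
    if "k \<in> I" for k
    using covering_card[OF covering[OF R] that] .
next
  show "\<exists>I A B. R X I A B" for X
    using partitioning partitioning_singletons by blast
  fix X Y :: "'a mat" and I A B J A' B'
  assume X: "R X I A B" and Y: "\<And>k. k \<in> I \<Longrightarrow> R Y (J k) (A' k) (B' k)"
  have sub: "A' k l \<subseteq> {..<dim_row Y}" "B' k l \<subseteq> {..<dim_col Y}" if "k \<in> I" "l \<in> J k" for k l
    using covering[OF Y[OF that(1)]] that(2) by (auto simp: is_covering_def)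
  let ?A = "\<lambda>x. block_set (dim_row Y) (A (fst (prod_decode x)))
    (A' (fst (prod_decode x)) (snd (prod_decode x)))"
  let ?B = "\<lambda>x. block_set (dim_col Y) (B (fst (prod_decode x)))
    (B' (fst (prod_decode x)) (snd (prod_decode x)))"
  have "R (kronecker X Y) (prod_encode ` Sigma I J) ?A ?B"
    using X Y by (rule kron)
  then show "\<exists>A'' B''. R (kronecker X Y) (prod_encode ` Sigma I J) A'' B'' \<and>
      (\<forall>k\<in>I. \<forall>l\<in>J k. card (A'' (prod_encode (k, l))) = card (A k) * card (A' k l) \<and>
        card (B'' (prod_encode (k, l))) = card (B k) * card (B' k l))"
    by (intro exI[of _ ?A] exI[of _ ?B] conjI) (simp_all add: card_block_set sub)
qed

lemma rectangle_families_covering: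
  fixes N :: "'a::semiring_1_no_zero_divisors mat"
  shows "rectangle_families (profile is_covering card N) (max_dim N)"
proof (rule rectangle_families_coverings)
  show "is_covering X I A B" if "is_partitioning X I A B" for X :: "'a mat" and I A B
    using that by (simp add: is_partitioning_def)
qed (assumption, rule covering_kronecker)

lemma rectangle_families_partitioning:
  fixes N :: "'a::semiring_1_no_zero_divisors mat"
  shows "rectangle_families (profile is_partitioning card N) (max_dim N)"
proof (rule rectangle_families_coverings)
  show "is_covering X I A B" if "is_partitioning X I A B" for X :: "'a mat" and I A B
    using that by (simp add: is_partitioning_def)
qed (assumption, rule partitioning_kronecker)

lemma sigma_OR_eq_SUP:
  fixes N :: "'a::semiring_1_no_zero_divisors mat"
  shows "sigma_OR N = (SUP \<alpha>\<in>{0..1}. sigma_OR_alpha \<alpha> N)"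
  unfolding sigma_OR_def sigma_OR_alpha_def min_size_OR_def inf_volume_OR_def rect_size_def
    rect_volume_def
  by (rule lim_size_eq_SUP_lim_volume[OF rectangle_families_covering])

lemma sigma_PAR_eq_SUP:
  fixes N :: "'a::semiring_1_no_zero_divisors mat"
  shows "sigma_PAR N = (SUP \<alpha>\<in>{0..1}. sigma_PAR_alpha \<alpha> N)"
  unfolding sigma_PAR_def sigma_PAR_alpha_def min_size_PAR_def inf_volume_PAR_def rect_size_def
    rect_volume_def
  by (rule lim_size_eq_SUP_lim_volume[OF rectangle_families_partitioning])

section \<open>Decompositions over a field\<close>

definition kronecker_vec :: "'a::times vec \<Rightarrow> 'a vec \<Rightarrow> 'a vec" where
  "kronecker_vec x y = vec (dim_vec x * dim_vec y) (\<lambda>i. x $ (i div dim_vec y) * y $ (i mod dim_vec y))"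

lemma dim_kronecker_vec [simp]: "dim_vec (kronecker_vec x y) = dim_vec x * dim_vec y"
  by (simp add: kronecker_vec_def)

text \<open>The support of the product vector is the \<open>block_set\<close> of the two
  supports.\<close>

lemma nnz_kronecker_vec:
  fixes x y :: "'a::semiring_no_zero_divisors vec"
  shows "nnz (kronecker_vec x y) = nnz x * nnz y"
proof -
  have "i < dim_vec x * dim_vec y \<and> kronecker_vec x y $ i \<noteq> 0 \<longleftrightarrow>
      (i div dim_vec y < dim_vec x \<and> x $ (i div dim_vec y) \<noteq> 0) \<and>
      (i mod dim_vec y < dim_vec y \<and> y $ (i mod dim_vec y) \<noteq> 0)" for i
  proof (cases "i < dim_vec x * dim_vec y")
    case True
    then show ?thesis using div_mod_less_mult[OF True] by (simp add: kronecker_vec_def)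
  next
    case False
    then show ?thesis by (auto simp: div_less_iff_less_mult)
  qed
  then have "{i. i < dim_vec (kronecker_vec x y) \<and> kronecker_vec x y $ i \<noteq> 0}
    = block_set (dim_vec y) {i. i < dim_vec x \<and> x $ i \<noteq> 0} {i. i < dim_vec y \<and> y $ i \<noteq> 0}"
    by (simp add: block_set_def kronecker_vec_def)
  then show ?thesis unfolding nnz_def by (simp add: card_block_set subset_iff)
qed

lemma nnz_le_dim: "nnz x \<le> dim_vec x"
  unfolding nnz_def using card_mono[of "{..<dim_vec x}" "{i. i < dim_vec x \<and> x $ i \<noteq> 0}"] by auto

lemma nnz_pos_iff: "x \<in> carrier_vec n \<Longrightarrow> 0 < nnz x \<longleftrightarrow> x \<noteq> 0\<^sub>v n"
  unfolding nnz_def by (auto simp: card_gt_0_iff)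

text \<open>Working form: positivity of \<open>nnz\<close> is what the locale asks for and passes to
  products by \<open>nnz_kronecker_vec\<close>, and entries are what sums are compared on.\<close>

lemma is_decomposition_iff:
  "is_decomposition M I U V \<longleftrightarrow>
     finite I \<and>
     (\<forall>k\<in>I. U k \<in> carrier_vec (dim_row M) \<and> 0 < nnz (U k)) \<and>
     (\<forall>k\<in>I. V k \<in> carrier_vec (dim_col M) \<and> 0 < nnz (V k)) \<and>
     (\<forall>i<dim_row M. \<forall>j<dim_col M. M $$ (i, j) = (\<Sum>k\<in>I. U k $ i * V k $ j))"
proof -
  have "M = mat (dim_row M) (dim_col M) (\<lambda>(i, j). \<Sum>k\<in>I. U k $ i * V k $ j) \<longleftrightarrow>
    (\<forall>i<dim_row M. \<forall>j<dim_col M. M $$ (i, j) = (\<Sum>k\<in>I. U k $ i * V k $ j))"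
    by (subst mat_eq_iff) auto
  then show ?thesis
    unfolding is_decomposition_def by (simp add: nnz_pos_iff cong: conj_cong)
qed

text \<open>By bilinearity, \<open>X\<close> is expanded first; each of its rank-one terms is then
  multiplied by its own copy of \<open>Y\<close>, which may be decomposed separately.\<close>

lemma decomposition_kronecker:
  fixes X Y :: "'a::idom mat"
  assumes X: "is_decomposition X I U V"
    and Y: "\<And>k. k \<in> I \<Longrightarrow> is_decomposition Y (J k) (U' k) (V' k)"
  shows "is_decomposition (kronecker X Y) (prod_encode ` Sigma I J)
    (\<lambda>x. kronecker_vec (U (fst (prod_decode x))) (U' (fst (prod_decode x)) (snd (prod_decode x))))
    (\<lambda>x. kronecker_vec (V (fst (prod_decode x))) (V' (fst (prod_decode x)) (snd (prod_decode x))))"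
    (is "is_decomposition _ ?K ?U ?V")
proof -
  have fI: "finite I" and fJ: "\<And>k. k \<in> I \<Longrightarrow> finite (J k)"
    using X Y by (auto simp: is_decomposition_iff)
  then have fK: "finite ?K" by auto
  have U: "dim_vec (U k) = dim_row X" "0 < nnz (U k)" "dim_vec (V k) = dim_col X" "0 < nnz (V k)"
    if "k \<in> I" for k
    using X that by (auto simp: is_decomposition_iff)
  have U': "dim_vec (U' k l) = dim_row Y" "0 < nnz (U' k l)"
      "dim_vec (V' k l) = dim_col Y" "0 < nnz (V' k l)" if "k \<in> I" "l \<in> J k" for k l
    using Y[OF that(1)] that(2) by (auto simp: is_decomposition_iff)
  have vecs: "?U x \<in> carrier_vec (dim_row (kronecker X Y)) \<and> 0 < nnz (?U x)"
    "?V x \<in> carrier_vec (dim_col (kronecker X Y)) \<and> 0 < nnz (?V x)" if mem: "x \<in> ?K" for x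
  proof -
    obtain k l where kl: "k \<in> I" "l \<in> J k" and x: "x = prod_encode (k, l)" using mem by auto
    have Ux: "?U x = kronecker_vec (U k) (U' k l)" and Vx: "?V x = kronecker_vec (V k) (V' k l)"
      unfolding x by simp_all
    show "?U x \<in> carrier_vec (dim_row (kronecker X Y)) \<and> 0 < nnz (?U x)"
      "?V x \<in> carrier_vec (dim_col (kronecker X Y)) \<and> 0 < nnz (?V x)"
      unfolding Ux Vx nnz_kronecker_vec
      by (intro conjI carrier_vecI; simp add: U[OF kl(1)] U'[OF kl])+
  qed
  have entry: "kronecker X Y $$ (i, j) = (\<Sum>x\<in>?K. ?U x $ i * ?V x $ j)"
    if i: "i < dim_row X * dim_row Y" and j: "j < dim_col X * dim_col Y" for i j
  proof -
    note ij = div_mod_less_mult[OF i] div_mod_less_mult[OF j]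
    have "kronecker X Y $$ (i, j) = X $$ (i div dim_row Y, j div dim_col Y) *
        Y $$ (i mod dim_row Y, j mod dim_col Y)"
      using i j by (rule index_kronecker)
    also have "\<dots> = (\<Sum>k\<in>I. U k $ (i div dim_row Y) * V k $ (j div dim_col Y) *
        Y $$ (i mod dim_row Y, j mod dim_col Y))"
      using X ij by (simp add: is_decomposition_iff sum_distrib_right)
    also have "\<dots> = (\<Sum>k\<in>I. \<Sum>l\<in>J k. kronecker_vec (U k) (U' k l) $ i * kronecker_vec (V k) (V' k l) $ j)"
    proof (rule sum.cong[OF refl])
      fix k assume k: "k \<in> I"
      \<comment> \<open>Only the copy of \<open>Y\<close> in the summand \<open>k\<close> is
        expanded, by the decomposition chosen for that \<open>k\<close>.\<close>
      have "U k $ (i div dim_row Y) * V k $ (j div dim_col Y) * Y $$ (i mod dim_row Y, j mod dim_col Y)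
        = (\<Sum>l\<in>J k. U k $ (i div dim_row Y) * V k $ (j div dim_col Y) *
            (U' k l $ (i mod dim_row Y) * V' k l $ (j mod dim_col Y)))"
        using Y[OF k] ij by (simp add: is_decomposition_iff sum_distrib_left)
      also have "\<dots> = (\<Sum>l\<in>J k. kronecker_vec (U k) (U' k l) $ i * kronecker_vec (V k) (V' k l) $ j)"
        using U[OF k] U'[OF k] i j by (intro sum.cong refl) (simp add: kronecker_vec_def mult_ac)
      finally show "U k $ (i div dim_row Y) * V k $ (j div dim_col Y) *
          Y $$ (i mod dim_row Y, j mod dim_col Y)
        = (\<Sum>l\<in>J k. kronecker_vec (U k) (U' k l) $ i * kronecker_vec (V k) (V' k l) $ j)" .
    qed
    also have "\<dots> = (\<Sum>x\<in>?K. ?U x $ i * ?V x $ j)"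
      using fI fJ by (rule sum_prod_encode_Sigma[symmetric])
    finally show ?thesis .
  qed
  show ?thesis
    unfolding is_decomposition_iff using fK vecs entry by (simp only: dim_kronecker) blast
qed

text \<open>One rank-one term per nonzero entry, with the entry as scalar on the left vector; it
  shows that decompositions exist.\<close>

lemma decomposition_entries:
  "is_decomposition X (prod_encode ` supp_mat X)
    (\<lambda>x. X $$ prod_decode x \<cdot>\<^sub>v unit_vec (dim_row X) (fst (prod_decode x)))
    (\<lambda>x. unit_vec (dim_col X) (snd (prod_decode x)))"
  (is "is_decomposition X ?K ?U ?V")
  unfolding is_decomposition_def
proof (intro conjI ballI)
  show "finite ?K" by (simp add: finite_supp_mat)
  fix x assume "x \<in> ?K"
  then obtain i j where x: "x = prod_encode (i, j)" "i < dim_row X" "j < dim_col X" "X $$ (i, j) \<noteq> 0"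
    by (auto simp: supp_mat_def)
  then have "?U x $ i \<noteq> 0\<^sub>v (dim_row X) $ i" "?V x $ j \<noteq> 0\<^sub>v (dim_col X) $ j" by simp_all
  then show "?U x \<noteq> 0\<^sub>v (dim_row X)" "?V x \<noteq> 0\<^sub>v (dim_col X)" by metis+
  show "?U x \<in> carrier_vec (dim_row X)" "?V x \<in> carrier_vec (dim_col X)" by auto
next
  show "X = mat (dim_row X) (dim_col X) (\<lambda>(i, j). \<Sum>x\<in>?K. ?U x $ i * ?V x $ j)"
  proof (rule eq_matI)
    fix i j assume "i < dim_row (mat (dim_row X) (dim_col X) (\<lambda>(i, j). \<Sum>x\<in>?K. ?U x $ i * ?V x $ j))"
      "j < dim_col (mat (dim_row X) (dim_col X) (\<lambda>(i, j). \<Sum>x\<in>?K. ?U x $ i * ?V x $ j))"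
    then have ij: "i < dim_row X" "j < dim_col X" by simp_all
    have "(\<Sum>x\<in>?K. ?U x $ i * ?V x $ j) = (\<Sum>p\<in>supp_mat X. if p = (i, j) then X $$ p else 0)"
      using ij by (subst sum.reindex) (auto simp: inj_prod_encode supp_mat_def unit_vec_def intro!: sum.cong)
    also have "\<dots> = X $$ (i, j)"
      using ij by (simp add: sum.delta' finite_supp_mat) (auto simp: supp_mat_def)
    finally show "X $$ (i, j)
        = mat (dim_row X) (dim_col X) (\<lambda>(i, j). \<Sum>x\<in>?K. ?U x $ i * ?V x $ j) $$ (i, j)"
      using ij by simp
  qed simp_all
qed

lemma rectangle_families_decompositions:
  fixes M :: "'a::idom mat"
  shows "rectangle_families (profile is_decomposition nnz M) (max_dim M)"
proof (rule rectangle_families_profile)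
  fix X :: "'a mat" and I U V assume *: "is_decomposition X I U V"
  then show "finite I" by (simp add: is_decomposition_def)
  fix k assume "k \<in> I"
  then show "0 < nnz (U k) \<and> nnz (U k) \<le> dim_row X" "0 < nnz (V k) \<and> nnz (V k) \<le> dim_col X"
    using * nnz_le_dim[of "U k"] nnz_le_dim[of "V k"] by (auto simp: is_decomposition_iff)
next
  show "\<exists>I U V. is_decomposition X I U V" for X :: "'a mat"
    using decomposition_entries by blast
  fix X Y :: "'a mat" and I U V J U' V'
  assume "is_decomposition X I U V" "\<And>k. k \<in> I \<Longrightarrow> is_decomposition Y (J k) (U' k) (V' k)"
  note D = decomposition_kronecker[where J = J and U' = U' and V' = V', OF this]
  show "\<exists>U'' V''. is_decomposition (kronecker X Y) (prod_encode ` Sigma I J) U'' V'' \<and>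
      (\<forall>k\<in>I. \<forall>l\<in>J k. nnz (U'' (prod_encode (k, l))) = nnz (U k) * nnz (U' k l) \<and>
        nnz (V'' (prod_encode (k, l))) = nnz (V k) * nnz (V' k l))"
    by (intro exI conjI, rule D) (auto simp: nnz_kronecker_vec)
qed

lemma sigma_eq_SUP:
  fixes M :: "'a::idom mat"
  shows "sigma M = (SUP \<alpha>\<in>{0..1}. sigma_alpha \<alpha> M)"
  unfolding sigma_def sigma_alpha_def min_size_def inf_volume_def decomp_size_def decomp_volume_def
  by (rule lim_size_eq_SUP_lim_volume[OF rectangle_families_decompositions])

theorem theorem4p1:
  fixes M :: "'a::field mat" and N :: "nat mat"
  shows "sigma M = (SUP \<alpha>\<in>{0..1}. sigma_alpha \<alpha> M) \<and>
    (binary_mat N \<longrightarrow>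
       sigma_OR N = (SUP \<alpha>\<in>{0..1}. sigma_OR_alpha \<alpha> N) \<and>
       sigma_PAR N = (SUP \<alpha>\<in>{0..1}. sigma_PAR_alpha \<alpha> N))"
  using sigma_eq_SUP sigma_OR_eq_SUP sigma_PAR_eq_SUP by blast

end
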